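(* Let $(U,\gamma)$ be a parallelism structure and $(U,g)$ a metric structure on $U$, and let $(\nabla_a^{+},\nabla_a^{-})$ be the pair of $a$-directional covariant derivative operators associated to $(U,\gamma)$. Then $(U,\gamma)$ is compatible with $(U,g)$ (that is, $g\circ\gamma_a+\gamma_a^{\dagger}\circ g=a\cdot\partial_og$ for all $a$) if and only if $(\nabla_a^{+},\nabla_a^{-})$ is metric compatible (that is, $\nabla_a^{++}g=0$ for all $a$).
   Context: $M$ is an $n$-dimensional smooth manifold, $(U_o,\phi_o)$ a chart with coordinates $x^1,\dots,x^n$, and $U\subset U_o$ open. The canonical space $\mathcal{U}_o$ is an $n$-dimensional real vector space with basis $b_1,\dots,b_n$ and the Euclidean scalar product $b_\mu\cdot b_\nu=\delta_{\mu\nu}$; ${}^\dagger$ is the Euclidean adjoint. $\mathcal{V}(U)$ denotes the smooth maps $U\to\mathcal{U}_o$. For $a\in\mathcal{U}_o$, $a\cdot\partial_o=\sum_\mu(a\cdot b_\mu)\,\partial/\partial x^\mu$ (componentwise); for a smooth field $g$ of endomorphisms of $\mathcal{U}_o$, $(a\cdot\partial_og)(b)=a\cdot\partial_o(g(b))-g(a\cdot\partial_ob)$. A metric structure $(U,g)$: $g$ is a smooth field of endomorphisms of $\mathcal{U}_o$ on $U$ with $g=g^\dagger$ and $\det[g]\ne0$ everywhere. A parallelism structure $(U,\gamma)$: $\gamma$ is a smooth map on $U$ with values bilinear maps $\mathcal{U}_o\times\mathcal{U}_o\to\mathcal{U}_o$; $\gamma_a(b)=\gamma(a,b)$. On vector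 fields $b$: $\nabla_a^{+}b=a\cdot\partial_ob+\gamma_a(b)$ and $\nabla_a^{-}b=a\cdot\partial_ob-\gamma_a^{\dagger}(b)$. The covariant derivative $\nabla_a^{++}g$ is defined by $(\nabla_a^{++}g)(b)\cdot c=a\cdot\partial_o(g(b)\cdot c)-g(\nabla_a^{+}b)\cdot c-g(b)\cdot\nabla_a^{+}c$ for $b,c\in\mathcal{V}(U)$. *)

theory Defs
  imports "HOL-Analysis.Analysis"
begin

fun times_differentiable_on ::
  "nat \<Rightarrow> 'a::real_normed_vector set \<Rightarrow> ('a \<Rightarrow> 'b::real_normed_vector) \<Rightarrow> bool" where
  "times_differentiable_on 0 S f \<longleftrightarrow> continuous_on S f"
| "times_differentiable_on (Suc k) S f \<longleftrightarrow>
     (\<forall>x\<in>S. f differentiable (at x)) \<and>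
     (\<forall>h. times_differentiable_on k S (\<lambda>x. frechet_derivative f (at x) h))"

text \<open>Only meaningful for open \<open>S\<close>, since derivatives are taken in the full space.\<close>

definition smooth_on :: "'a::real_normed_vector set \<Rightarrow> ('a \<Rightarrow> 'b::real_normed_vector) \<Rightarrow> bool" where
  "smooth_on S f \<longleftrightarrow> (\<forall>k. times_differentiable_on k S f)"

type_synonym ('m, 'n) chart = "'m set \<times> ('m \<Rightarrow> real^'n)"

text \<open>A chart is a pair of a domain and a map whose values outside the domain are irrelevant;
  the dimension of the manifold is \<open>CARD('n)\<close>.\<close>

definition smooth_manifold :: "'m topology \<Rightarrow> ('m, 'n::finite) chart set \<Rightarrow> bool" where
  "smooth_manifold M atlas \<longleftrightarrow>
     Hausdorff_space M \<and> second_countable M \<and>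
     (\<forall>(V, \<psi>)\<in>atlas. openin M V \<and> open (\<psi> ` V) \<and>
        homeomorphic_map (subtopology M V) (top_of_set (\<psi> ` V)) \<psi>) \<and>
     \<Union> (fst ` atlas) = topspace M \<and>
     (\<forall>(V, \<psi>)\<in>atlas. \<forall>(W, \<theta>)\<in>atlas. smooth_on (\<psi> ` (V \<inter> W)) (\<theta> \<circ> inv_into V \<psi>))"

text \<open>Smoothness, in the chart \<open>(Uo, \<phi>)\<close>, of a map on an open set \<open>U \<subseteq> Uo\<close>.\<close>

definition smooth_in_chart ::
  "'m set \<Rightarrow> ('m \<Rightarrow> real^'n::finite) \<Rightarrow> 'm set \<Rightarrow> ('m \<Rightarrow> 'v::real_normed_vector) \<Rightarrow> bool" where
  "smooth_in_chart Uo \<phi> U f \<longleftrightarrow> smooth_on (\<phi> ` U) (f \<circ> inv_into Uo \<phi>)"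

text \<open>The canonical space is a Euclidean space \<open>'u\<close> whose distinguished basis \<open>b\<close> is indexed, like
  the coordinates, by \<open>'n\<close>. Since linear maps in finite dimension are bounded, its endomorphisms
  are the elements of \<open>'u \<Rightarrow>\<^sub>L 'u\<close> and its bilinear maps those of \<open>'u \<Rightarrow>\<^sub>L 'u \<Rightarrow>\<^sub>L 'u\<close>.\<close>

definition canonical_basis :: "('n::finite \<Rightarrow> 'u::euclidean_space) \<Rightarrow> bool" where
  "canonical_basis b \<longleftrightarrow>
     (\<forall>\<mu> \<nu>. b \<mu> \<bullet> b \<nu> = (if \<mu> = \<nu> then 1 else 0)) \<and> span (range b) = UNIV"

text \<open>Fields are total functions; only their values on the open set under consideration matter.\<close>

definition vector_fields ::
  "'m set \<Rightarrow> ('m \<Rightarrow> real^'n::finite) \<Rightarrow> 'm set \<Rightarrow> ('m \<Rightarrow> 'u::euclidean_space) set" where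
  "vector_fields Uo \<phi> U = {v. smooth_in_chart Uo \<phi> U v}"

definition coord_deriv ::
  "'m set \<Rightarrow> ('m \<Rightarrow> real^'n::finite) \<Rightarrow> 'n \<Rightarrow> ('m \<Rightarrow> real) \<Rightarrow> 'm \<Rightarrow> real" where
  "coord_deriv Uo \<phi> \<mu> f p = deriv (\<lambda>t. f (inv_into Uo \<phi> (\<phi> p + t *\<^sub>R axis \<mu> 1))) 0"

definition dir_deriv ::
  "'m set \<Rightarrow> ('m \<Rightarrow> real^'n::finite) \<Rightarrow> ('n \<Rightarrow> 'u::euclidean_space) \<Rightarrow> 'u \<Rightarrow>
   ('m \<Rightarrow> real) \<Rightarrow> 'm \<Rightarrow> real" where
  "dir_deriv Uo \<phi> b a f p = (\<Sum>\<mu>\<in>UNIV. (a \<bullet> b \<mu>) * coord_deriv Uo \<phi> \<mu> f p)"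

definition vec_dir_deriv ::
  "'m set \<Rightarrow> ('m \<Rightarrow> real^'n::finite) \<Rightarrow> ('n \<Rightarrow> 'u::euclidean_space) \<Rightarrow> 'u \<Rightarrow>
   ('m \<Rightarrow> 'u) \<Rightarrow> 'm \<Rightarrow> 'u" where
  "vec_dir_deriv Uo \<phi> b a v p = (\<Sum>\<nu>\<in>UNIV. dir_deriv Uo \<phi> b a (\<lambda>q. v q \<bullet> b \<nu>) p *\<^sub>R b \<nu>)"

definition endo_dir_deriv ::
  "'m set \<Rightarrow> ('m \<Rightarrow> real^'n::finite) \<Rightarrow> ('n \<Rightarrow> 'u::euclidean_space) \<Rightarrow> 'u \<Rightarrow>
   ('m \<Rightarrow> 'u \<Rightarrow>\<^sub>L 'u) \<Rightarrow> ('m \<Rightarrow> 'u) \<Rightarrow> 'm \<Rightarrow> 'u" where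
  "endo_dir_deriv Uo \<phi> b a g v p =
     vec_dir_deriv Uo \<phi> b a (\<lambda>q. g q (v q)) p - g p (vec_dir_deriv Uo \<phi> b a v p)"

definition endo_det :: "('n::finite \<Rightarrow> 'u::euclidean_space) \<Rightarrow> ('u \<Rightarrow>\<^sub>L 'u) \<Rightarrow> real" where
  "endo_det b h = det (\<chi> \<mu> \<nu>. b \<mu> \<bullet> h (b \<nu>))"

definition metric_structure ::
  "'m set \<Rightarrow> ('m \<Rightarrow> real^'n::finite) \<Rightarrow> ('n \<Rightarrow> 'u::euclidean_space) \<Rightarrow> 'm set \<Rightarrow>
   ('m \<Rightarrow> 'u \<Rightarrow>\<^sub>L 'u) \<Rightarrow> bool" where
  "metric_structure Uo \<phi> b U g \<longleftrightarrow>
     smooth_in_chart Uo \<phi> U g \<and>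
     (\<forall>p\<in>U. blinfun_apply (g p) = adjoint (blinfun_apply (g p)) \<and> endo_det b (g p) \<noteq> 0)"

definition parallelism_structure ::
  "'m set \<Rightarrow> ('m \<Rightarrow> real^'n::finite) \<Rightarrow> 'm set \<Rightarrow>
   ('m \<Rightarrow> 'u::euclidean_space \<Rightarrow>\<^sub>L 'u \<Rightarrow>\<^sub>L 'u) \<Rightarrow> bool" where
  "parallelism_structure Uo \<phi> U \<gamma> \<longleftrightarrow> smooth_in_chart Uo \<phi> U \<gamma>"

definition nabla_plus ::
  "'m set \<Rightarrow> ('m \<Rightarrow> real^'n::finite) \<Rightarrow> ('n \<Rightarrow> 'u::euclidean_space) \<Rightarrow>
   ('m \<Rightarrow> 'u \<Rightarrow>\<^sub>L 'u \<Rightarrow>\<^sub>L 'u) \<Rightarrow> 'u \<Rightarrow> ('m \<Rightarrow> 'u) \<Rightarrow> 'm \<Rightarrow> 'u" where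
  "nabla_plus Uo \<phi> b \<gamma> a v p = vec_dir_deriv Uo \<phi> b a v p + \<gamma> p a (v p)"

definition nabla_minus ::
  "'m set \<Rightarrow> ('m \<Rightarrow> real^'n::finite) \<Rightarrow> ('n \<Rightarrow> 'u::euclidean_space) \<Rightarrow>
   ('m \<Rightarrow> 'u \<Rightarrow>\<^sub>L 'u \<Rightarrow>\<^sub>L 'u) \<Rightarrow> 'u \<Rightarrow> ('m \<Rightarrow> 'u) \<Rightarrow> 'm \<Rightarrow> 'u" where
  "nabla_minus Uo \<phi> b \<gamma> a v p =
     vec_dir_deriv Uo \<phi> b a v p - adjoint (blinfun_apply (\<gamma> p a)) (v p)"

definition nabla_pair ::
  "'m set \<Rightarrow> ('m \<Rightarrow> real^'n::finite) \<Rightarrow> ('n \<Rightarrow> 'u::euclidean_space) \<Rightarrow>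
   ('m \<Rightarrow> 'u \<Rightarrow>\<^sub>L 'u \<Rightarrow>\<^sub>L 'u) \<Rightarrow> 'u \<Rightarrow>
   (('m \<Rightarrow> 'u) \<Rightarrow> 'm \<Rightarrow> 'u) \<times> (('m \<Rightarrow> 'u) \<Rightarrow> 'm \<Rightarrow> 'u)" where
  "nabla_pair Uo \<phi> b \<gamma> a = (nabla_plus Uo \<phi> b \<gamma> a, nabla_minus Uo \<phi> b \<gamma> a)"

text \<open>The value at \<open>p\<close> of the vector field \<open>(\<nabla>\<^sub>a\<^sup>+\<^sup>+ g)(v)\<close>, determined by its scalar products with all
  smooth vector fields; \<open>D\<close> is the operator \<open>\<nabla>\<^sub>a\<^sup>+\<close>. Constant fields give uniqueness; existence, for
  the operators \<open>nabla_plus\<close>, follows from the Leibniz rule.\<close>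

definition nabla_plus_plus ::
  "'m set \<Rightarrow> ('m \<Rightarrow> real^'n::finite) \<Rightarrow> ('n \<Rightarrow> 'u::euclidean_space) \<Rightarrow> 'm set \<Rightarrow> 'u \<Rightarrow>
   (('m \<Rightarrow> 'u) \<Rightarrow> 'm \<Rightarrow> 'u) \<Rightarrow> ('m \<Rightarrow> 'u \<Rightarrow>\<^sub>L 'u) \<Rightarrow> ('m \<Rightarrow> 'u) \<Rightarrow> 'm \<Rightarrow> 'u" where
  "nabla_plus_plus Uo \<phi> b U a D g v p =
     (THE w. \<forall>c\<in>vector_fields Uo \<phi> U.
        w \<bullet> c p = dir_deriv Uo \<phi> b a (\<lambda>q. g q (v q) \<bullet> c q) p
                 - g p (D v p) \<bullet> c p - g p (v p) \<bullet> D c p)"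

text \<open>Equality of fields of endomorphisms on \<open>U\<close> is equality of the operators they induce on the
  smooth vector fields, which is how \<open>a\<cdot>\<partial>\<^sub>o g\<close> and \<open>\<nabla>\<^sub>a\<^sup>+\<^sup>+ g\<close> are defined.\<close>

definition compatible ::
  "'m set \<Rightarrow> ('m \<Rightarrow> real^'n::finite) \<Rightarrow> ('n \<Rightarrow> 'u::euclidean_space) \<Rightarrow> 'm set \<Rightarrow>
   ('m \<Rightarrow> 'u \<Rightarrow>\<^sub>L 'u \<Rightarrow>\<^sub>L 'u) \<Rightarrow> ('m \<Rightarrow> 'u \<Rightarrow>\<^sub>L 'u) \<Rightarrow> bool" where
  "compatible Uo \<phi> b U \<gamma> g \<longleftrightarrow>
     (\<forall>a. \<forall>v\<in>vector_fields Uo \<phi> U. \<forall>p\<in>U.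
        (g p \<circ> \<gamma> p a) (v p) + (adjoint (blinfun_apply (\<gamma> p a)) \<circ> g p) (v p)
        = endo_dir_deriv Uo \<phi> b a g v p)"

definition metric_compatible ::
  "'m set \<Rightarrow> ('m \<Rightarrow> real^'n::finite) \<Rightarrow> ('n \<Rightarrow> 'u::euclidean_space) \<Rightarrow> 'm set \<Rightarrow>
   ('u \<Rightarrow> (('m \<Rightarrow> 'u) \<Rightarrow> 'm \<Rightarrow> 'u) \<times> (('m \<Rightarrow> 'u) \<Rightarrow> 'm \<Rightarrow> 'u)) \<Rightarrow>
   ('m \<Rightarrow> 'u \<Rightarrow>\<^sub>L 'u) \<Rightarrow> bool" where
  "metric_compatible Uo \<phi> b U DD g \<longleftrightarrow>
     (\<forall>a. \<forall>v\<in>vector_fields Uo \<phi> U. \<forall>p\<in>U. nabla_plus_plus Uo \<phi> b U a (fst (DD a)) g v p = 0)"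

end

theory Submission
  imports Defs
begin

text \<open>With \<open>v'\<close>, \<open>c'\<close>, \<open>g'\<close> the derivatives in the direction \<open>a\<close> of the local
  representatives, the Leibniz rule gives
  \<open>a\<cdot>\<partial>\<^sub>o (g v \<cdot> c) = g' v \<cdot> c + g v' \<cdot> c + g v \<cdot> c'\<close>, so the terms containing
  \<open>v'\<close> and \<open>c'\<close> cancel in the definition of \<open>\<nabla>\<^sub>a\<^sup>+\<^sup>+ g\<close>. What remains is
  \<open>\<nabla>\<^sub>a\<^sup>+\<^sup>+ g = a\<cdot>\<partial>\<^sub>o g - g \<circ> \<gamma>\<^sub>a - \<gamma>\<^sub>a\<^sup>\<dagger> \<circ> g\<close>, pointwise on \<open>U\<close>.\<close>

lemma times_differentiable_on_const: "times_differentiable_on k S (\<lambda>x. c)"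
  by (induction k arbitrary: c) (auto simp: frechet_derivative_const)

lemma const_in_vector_fields: "(\<lambda>q. c) \<in> vector_fields Uo \<phi> U"
  by (simp add: vector_fields_def smooth_in_chart_def smooth_on_def comp_def
      times_differentiable_on_const)

lemma smooth_in_chart_has_derivative:
  assumes "smooth_in_chart Uo \<phi> U f" and "p \<in> U"
  obtains f' where "(f \<circ> inv_into Uo \<phi> has_derivative f') (at (\<phi> p))"
proof -
  have "times_differentiable_on (Suc 0) (\<phi> ` U) (f \<circ> inv_into Uo \<phi>)"
    using assms(1) unfolding smooth_in_chart_def smooth_on_def by blast
  then have "(f \<circ> inv_into Uo \<phi>) differentiable (at (\<phi> p))"
    using assms(2) by simp
  then show thesis
    using that unfolding differentiable_def by blast
qed

text \<open>By orthonormality, the difference of the two sides is orthogonal to every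
  \<open>b \<mu>\<close>. It also lies in their span, so it is orthogonal to itself and
  vanishes.\<close>

lemma canonical_basis_expansion:
  fixes b :: "'n::finite \<Rightarrow> 'u::euclidean_space"
  assumes "canonical_basis b"
  shows "(\<Sum>\<nu>\<in>UNIV. (w \<bullet> b \<nu>) *\<^sub>R b \<nu>) = w"
proof -
  let ?d = "w - (\<Sum>\<nu>\<in>UNIV. (w \<bullet> b \<nu>) *\<^sub>R b \<nu>)"
  have ortho: "b \<nu> \<bullet> b \<mu> = (if \<nu> = \<mu> then 1 else 0)" for \<mu> \<nu>
    using assms by (simp add: canonical_basis_def)
  have "orthogonal ?d (b \<mu>)" for \<mu>
    by (simp add: orthogonal_def inner_diff_left inner_sum_left ortho
        if_distrib[of "(*) _"] cong: if_cong)
  moreover have "?d \<in> span (range b)"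
    using assms by (simp add: canonical_basis_def)
  ultimately have "orthogonal ?d ?d"
    using orthogonal_to_span[of ?d "range b" ?d] by auto
  then show ?thesis
    by (simp add: orthogonal_def)
qed

text \<open>The image of \<open>a\<close> under the isometry sending \<open>b \<mu>\<close> to the
  coordinate axis \<open>\<mu>\<close>. Frechet derivatives of local representatives are evaluated
  on it.\<close>

definition coord_vector :: "('n::finite \<Rightarrow> 'u::euclidean_space) \<Rightarrow> 'u \<Rightarrow> real^'n" where
  "coord_vector b a = (\<Sum>\<mu>\<in>UNIV. (a \<bullet> b \<mu>) *\<^sub>R axis \<mu> 1)"

text \<open>Chain rule along the coordinate line through \<open>\<phi> p\<close>.\<close>

lemma coord_deriv_eq:
  assumes "(f \<circ> inv_into Uo \<phi> has_derivative f') (at (\<phi> p))"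
  shows "coord_deriv Uo \<phi> \<mu> f p = f' (axis \<mu> 1)"
proof -
  interpret bounded_linear f'
    using assms by (rule has_derivative_bounded_linear)
  have line: "((\<lambda>t. \<phi> p + t *\<^sub>R axis \<mu> 1) has_derivative (\<lambda>t. t *\<^sub>R axis \<mu> 1)) (at 0)"
    by (auto intro!: derivative_eq_intros)
  have "(f \<circ> inv_into Uo \<phi> has_derivative f') (at (\<phi> p + 0 *\<^sub>R axis \<mu> 1))"
    using assms by simp
  from has_derivative_compose[OF line this]
  have "((\<lambda>t. f (inv_into Uo \<phi> (\<phi> p + t *\<^sub>R axis \<mu> 1)))
          has_field_derivative f' (axis \<mu> 1)) (at 0)"
    by (simp add: has_field_derivative_def scaleR mult_commute_abs)
  then show ?thesis
    unfolding coord_deriv_def by (rule DERIV_imp_deriv)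
qed

text \<open>Linearity of \<open>f'\<close> gathers the partial derivatives into one value of the
  Frechet derivative, so that the product rules for \<open>has_derivative\<close> become
  available.\<close>

lemma dir_deriv_eq:
  assumes "(f \<circ> inv_into Uo \<phi> has_derivative f') (at (\<phi> p))"
  shows "dir_deriv Uo \<phi> b a f p = f' (coord_vector b a)"
proof -
  interpret bounded_linear f'
    using assms by (rule has_derivative_bounded_linear)
  show ?thesis
    by (simp add: dir_deriv_def coord_vector_def coord_deriv_eq[OF assms] sum scaleR)
qed

lemma vec_dir_deriv_eq:
  assumes "canonical_basis b"
    and "(v \<circ> inv_into Uo \<phi> has_derivative v') (at (\<phi> p))"
  shows "vec_dir_deriv Uo \<phi> b a v p = v' (coord_vector b a)"
proof -
  have "((\<lambda>q. v q \<bullet> b \<nu>) \<circ> inv_into Uo \<phi> has_derivative (\<lambda>h. v' h \<bullet> b \<nu>)) (at (\<phi> p))" for \<nu>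
    using has_derivative_inner_left[OF assms(2)] by (simp add: comp_def)
  then have "dir_deriv Uo \<phi> b a (\<lambda>q. v q \<bullet> b \<nu>) p = v' (coord_vector b a) \<bullet> b \<nu>" for \<nu>
    by (rule dir_deriv_eq)
  then show ?thesis
    by (simp add: vec_dir_deriv_def canonical_basis_expansion[OF assms(1)])
qed

lemma nabla_plus_plus_eq:
  fixes b :: "'n::finite \<Rightarrow> 'u::euclidean_space"
  assumes b: "canonical_basis b" and inj: "inj_on \<phi> Uo" and "p \<in> U" "U \<subseteq> Uo"
    and g: "smooth_in_chart Uo \<phi> U g" and v: "v \<in> vector_fields Uo \<phi> U"
  shows "nabla_plus_plus Uo \<phi> b U a (nabla_plus Uo \<phi> b \<gamma> a) g v p
    = endo_dir_deriv Uo \<phi> b a g v p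
      - (g p (\<gamma> p a (v p)) + adjoint (blinfun_apply (\<gamma> p a)) (g p (v p)))"
    (is "_ = ?w")
proof -
  let ?\<psi> = "inv_into Uo \<phi>" and ?a = "coord_vector b a"
  \<comment> \<open>Injectivity of the chart turns values of local representatives at
    \<open>\<phi> p\<close> into values of the fields at \<open>p\<close>.\<close>
  have \<psi>: "?\<psi> (\<phi> p) = p"
    using assms by (auto intro: inv_into_f_f)
  obtain g' where g': "(g \<circ> ?\<psi> has_derivative g') (at (\<phi> p))"
    using g \<open>p \<in> U\<close> by (rule smooth_in_chart_has_derivative)
  obtain v' where v': "(v \<circ> ?\<psi> has_derivative v') (at (\<phi> p))"
    using v \<open>p \<in> U\<close> unfolding vector_fields_def by (auto elim: smooth_in_chart_has_derivative)
  \<comment> \<open>Leibniz rule for the bilinear evaluation of an endomorphism on a vector; in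
    \<open>endo\<close> the term with \<open>v'\<close> then cancels.\<close>
  have gv: "((\<lambda>q. g q (v q)) \<circ> ?\<psi> has_derivative (\<lambda>h. g p (v' h) + g' h (v p))) (at (\<phi> p))"
    using bounded_bilinear.FDERIV[OF bounded_bilinear_blinfun_apply g' v']
    by (simp add: comp_def \<psi>)
  have endo: "endo_dir_deriv Uo \<phi> b a g v p = g' ?a (v p)"
    by (simp add: endo_dir_deriv_def vec_dir_deriv_eq[OF b gv] vec_dir_deriv_eq[OF b v'])
  \<comment> \<open>Once the terms with \<open>c'\<close> have cancelled, the expression depends on
    \<open>c\<close> only through \<open>c p\<close>. Hence one vector represents it for all
    \<open>c\<close>, which is the existence needed by \<open>THE\<close>.\<close>
  have eq: "dir_deriv Uo \<phi> b a (\<lambda>q. g q (v q) \<bullet> c q) p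
      - g p (nabla_plus Uo \<phi> b \<gamma> a v p) \<bullet> c p - g p (v p) \<bullet> nabla_plus Uo \<phi> b \<gamma> a c p
      = ?w \<bullet> c p" if c: "c \<in> vector_fields Uo \<phi> U" for c
  proof -
    obtain c' where c': "(c \<circ> ?\<psi> has_derivative c') (at (\<phi> p))"
      using c \<open>p \<in> U\<close> unfolding vector_fields_def by (auto elim: smooth_in_chart_has_derivative)
    have gvc: "((\<lambda>q. g q (v q) \<bullet> c q) \<circ> ?\<psi> has_derivative
        (\<lambda>h. g p (v p) \<bullet> c' h + (g p (v' h) + g' h (v p)) \<bullet> c p)) (at (\<phi> p))"
      using has_derivative_inner[OF gv c'] by (simp add: comp_def \<psi>)
    \<comment> \<open>\<open>adjoint\<close> is defined by a choice, so its characteristic identity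
      has to be obtained from linearity of the map.\<close>
    have adj: "adjoint (blinfun_apply (\<gamma> p a)) x \<bullet> y = x \<bullet> \<gamma> p a y" for x y
      by (rule adjoint_clauses(2)) (simp add: blinfun.bounded_linear_right bounded_linear.linear)
    show ?thesis
      by (simp add: dir_deriv_eq[OF gvc] nabla_plus_def vec_dir_deriv_eq[OF b v']
          vec_dir_deriv_eq[OF b c'] endo adj blinfun.add_right inner_add_left inner_add_right
          inner_diff_left)
  qed
  show ?thesis
    unfolding nabla_plus_plus_def
  proof (rule the_equality)
    show "\<forall>c\<in>vector_fields Uo \<phi> U. ?w \<bullet> c p = dir_deriv Uo \<phi> b a (\<lambda>q. g q (v q) \<bullet> c q) p
        - g p (nabla_plus Uo \<phi> b \<gamma> a v p) \<bullet> c p - g p (v p) \<bullet> nabla_plus Uo \<phi> b \<gamma> a c p"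
      using eq by simp
  next
    fix w
    assume "\<forall>c\<in>vector_fields Uo \<phi> U. w \<bullet> c p = dir_deriv Uo \<phi> b a (\<lambda>q. g q (v q) \<bullet> c q) p
        - g p (nabla_plus Uo \<phi> b \<gamma> a v p) \<bullet> c p - g p (v p) \<bullet> nabla_plus Uo \<phi> b \<gamma> a c p"
    then have "\<forall>c\<in>vector_fields Uo \<phi> U. w \<bullet> c p = ?w \<bullet> c p"
      using eq by simp
    \<comment> \<open>The constant field with value \<open>x\<close> realises an arbitrary vector at
      \<open>p\<close>.\<close>
    then have "w \<bullet> x = ?w \<bullet> x" for x
      by (rule bspec[OF _ const_in_vector_fields])
    then show "w = ?w"
      using vector_eq_rdot by blast
  qed
qed

text \<open>A homeomorphic map is injective on the whole space of its domain topology. Here that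
  space is \<open>V\<close>, because the open set \<open>V\<close> is contained in
  \<open>topspace M\<close>.\<close>

lemma smooth_manifold_chart_inj_on:
  assumes "smooth_manifold M atlas" and "(V, \<psi>) \<in> atlas"
  shows "inj_on \<psi> V"
proof -
  have "openin M V" and "homeomorphic_map (subtopology M V) (top_of_set (\<psi> ` V)) \<psi>"
    using assms unfolding smooth_manifold_def by auto
  then show ?thesis
    using homeomorphic_imp_injective_map openin_subset by (metis topspace_subtopology_subset)
qed

theorem mainTheorem9:
  fixes M :: "'m topology"
    and atlas :: "('m, 'n::finite) chart set"
    and Uo U :: "'m set"
    and \<phi> :: "'m \<Rightarrow> real^'n"
    and b :: "'n \<Rightarrow> 'u::euclidean_space"
    and \<gamma> :: "'m \<Rightarrow> 'u \<Rightarrow>\<^sub>L 'u \<Rightarrow>\<^sub>L 'u"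
    and g :: "'m \<Rightarrow> 'u \<Rightarrow>\<^sub>L 'u"
  assumes "smooth_manifold M atlas"
    and "(Uo, \<phi>) \<in> atlas"
    and "openin M U" and "U \<subseteq> Uo"
    and "canonical_basis b"
    and "parallelism_structure Uo \<phi> U \<gamma>"
    and "metric_structure Uo \<phi> b U g"
  shows "compatible Uo \<phi> b U \<gamma> g \<longleftrightarrow>
         metric_compatible Uo \<phi> b U (nabla_pair Uo \<phi> b \<gamma>) g"
proof -
  have "inj_on \<phi> Uo"
    using assms(1,2) by (rule smooth_manifold_chart_inj_on)
  moreover have "smooth_in_chart Uo \<phi> U g"
    using assms(7) by (simp add: metric_structure_def)
  \<comment> \<open>The equivalence already holds for each \<open>a\<close>, \<open>v\<close> and
    \<open>p\<close> separately, so the quantifiers of the two notions match.\<close>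
  ultimately have "nabla_plus_plus Uo \<phi> b U a (fst (nabla_pair Uo \<phi> b \<gamma> a)) g v p = 0 \<longleftrightarrow>
      (g p \<circ> \<gamma> p a) (v p) + (adjoint (blinfun_apply (\<gamma> p a)) \<circ> g p) (v p)
      = endo_dir_deriv Uo \<phi> b a g v p"
    if "v \<in> vector_fields Uo \<phi> U" "p \<in> U" for a v p
    using that assms(4,5) by (auto simp: nabla_pair_def nabla_plus_plus_eq)
  then show ?thesis
    unfolding compatible_def metric_compatible_def by simp
qed

end
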